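(* Let $M\mapsto M^*$ be the translation from the untyped monadic reflection calculus to the untyped effect handler calculus that is homomorphic on all core constructs and satisfies $(\mathtt{reflect}\,N)^*=\mathit{reflect}\,\{N^*\}$ and $(\mathtt{reify}_T\,M)^*=\mathtt{handle}\,M^*\,\mathtt{with}\,\{\mathtt{return}\,x\mapsto N_u^*\}\uplus\{\mathit{reflect}\,y\,f\mapsto N_b^*\}$ for $T=\mathtt{where}\{\mathtt{return}\,x=N_u;\ y\gg\!=f=N_b\}$, where $\mathit{reflect}$ is a fixed operation name. Then for all computations $M,N$ of the monadic reflection calculus, $M\to N$ implies $M^*\to^{+}N^*$.
   Context: Core syntax (shared). Values $V ::= x \mid () \mid (V_1,V_2) \mid \ell\,V \mid \{M\}$; computations $M,N ::= \mathtt{let}\,(x,y)=V\,\mathtt{in}\,M \mid \mathtt{case}\,V\,\mathtt{of}\,\{\ell_i x_i\mapsto M_i\}_i \mid V! \mid \mathtt{return}\,V \mid \mathtt{let}\,x\Leftarrow M\,\mathtt{in}\,N \mid \lambda x.M \mid M\,V \mid \langle M_1,M_2\rangle \mid \mathrm{prj}_i M$. Core $\beta$-rules: $\mathtt{let}\,(x,y)=(V_1,V_2)\,\mathtt{in}\,M \to_\beta M[V_1/x,V_2/y]$; $\mathtt{case}\,\ell_j V\,\mathtt{of}\,\{\dots\ell_j x_j\mapsto M_j\dots\}\to_\beta M_j[V/x_j]$; $\{M\}!\to_\beta M$; $\mathtt{let}\,x\Leftarrow\mathtt{return}\,V\,\mathtt{in}\,N\to_\beta N[V/x]$; $(\lambda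 x.M)V\to_\beta M[V/x]$; $\mathrm{prj}_i\langle M_1,M_2\rangle\to_\beta M_i$. Basic frames $B ::= \mathtt{let}\,x\Leftarrow[\,]\,\mathtt{in}\,N\mid[\,]\,V\mid\mathrm{prj}_i[\,]$; hoisting contexts $\mathcal{H}::=[\,]\mid\mathcal{H}[B]$. In each calculus $M\to N$ iff $M=K[M']$, $N=K[N']$ with $M'\to_\beta N'$ and $K$ an evaluation context of that calculus; $\to^+$ is the transitive closure. Monadic reflection calculus: monad terms $T=\mathtt{where}\{\mathtt{return}\,x=N_u;\ y\gg\!=f=N_b\}$; adds computations $\mathtt{reflect}\,N$ and $\mathtt{reify}_T\,M$; evaluation contexts $K::=[\,]\mid K[B]\mid K[\mathtt{reify}_T[\,]]$; extra rules $\mathtt{reify}_T(\mathtt{return}\,V)\to_\beta N_u[V/x]$ and $\mathtt{reify}_T\,\mathcal{H}[\mathtt{reflect}\,N]\to_\beta N_b[\{N\}/y,\{\lambda z.\mathtt{reify}_T\,\mathcal{H}[\mathtt{return}\,z]\}/f]$. Effect handler calculus: operation names $\mathit{op}$; adds computations $\mathit{op}\,V$ and $\mathtt{handle}\,M\,\mathtt{with}\,H$, where $H$ has a return clause $\mathtt{return}\,x\mapsto N_{\mathrm{ret}}$ and operation clauses $\mathit{op}\,p\,k\mapsto N_{\mathit{op}}$ for $\mathit{op}$ in a finite set $\mathrm{ops}(H)$; evaluation contexts $K::=[\,]\mid K[B]\mid K[\mathtt{handle}\,[\,]\,\mathtt{with}\,H]$; extra rules $\mathtt{handle}\,(\mathtt{return}\,V)\,\mathtt{with}\,H\to_\beta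 N_{\mathrm{ret}}[V/x]$ and $\mathtt{handle}\,\mathcal{H}[\mathit{op}\,V]\,\mathtt{with}\,H\to_\beta N_{\mathit{op}}[V/p,\{\lambda y.\mathtt{handle}\,\mathcal{H}[\mathtt{return}\,y]\,\mathtt{with}\,H\}/k]$ for $\mathit{op}\in\mathrm{ops}(H)$. *)

theory Defs
  imports "HOL-Library.Finite_Map"
begin

text \<open>
  Terms are de Bruijn terms; all variables range over values.  Labels and operation names are
  type parameters \<open>'l\<close> and \<open>'o\<close>.  The branches of a case and the operation clauses of a
  handler are finite maps, hence finite families indexed by distinct labels or operation names.

  A constructor that binds two variables at once binds the first one as index 0 and the
  second one as index 1:
  \<open>x\<close>, \<open>y\<close> in \<open>let (x, y) = V in M\<close>; \<open>y\<close>, \<open>f\<close> in the bind clause \<open>y >>= f = Nb\<close> of a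
  monad term; \<open>p\<close>, \<open>k\<close> in an operation clause \<open>op p k \<mapsto> N\<close>.
  Accordingly \<open>msubst2 M V W\<close> and \<open>esubst2 M V W\<close> simultaneously replace index 0 by \<open>V\<close> and
  index 1 by \<open>W\<close>, and lower the remaining indices by 2.

  The holes of frames and contexts are never below a binder, so plugging needs no renaming.
\<close>

datatype side = Fst | Snd

definition ren_up :: "(nat \<Rightarrow> nat) \<Rightarrow> nat \<Rightarrow> nat" where
  "ren_up r n = (case n of 0 \<Rightarrow> 0 | Suc k \<Rightarrow> Suc (r k))"

section \<open>The monadic reflection calculus\<close>

datatype 'l mvalue =
    MVar nat
  | MUnit
  | MPair "'l mvalue" "'l mvalue"
  | MInj 'l "'l mvalue"
  | MThunk "'l mcomp"
and 'l mcomp =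
    MSplit "'l mvalue" "'l mcomp"
  | MCase "'l mvalue" "('l, 'l mcomp) fmap"
  | MForce "'l mvalue"
  | MReturn "'l mvalue"
  | MLet "'l mcomp" "'l mcomp"
  | MLam "'l mcomp"
  | MApp "'l mcomp" "'l mvalue"
  | MCPair "'l mcomp" "'l mcomp"
  | MPrj side "'l mcomp"
  | MReflect "'l mcomp"
  | MReify "'l mmonad" "'l mcomp"
and 'l mmonad =
    MWhere "'l mcomp" "'l mcomp"

primrec mren_val :: "(nat \<Rightarrow> nat) \<Rightarrow> 'l mvalue \<Rightarrow> 'l mvalue"
  and mren_comp :: "(nat \<Rightarrow> nat) \<Rightarrow> 'l mcomp \<Rightarrow> 'l mcomp"
  and mren_monad :: "(nat \<Rightarrow> nat) \<Rightarrow> 'l mmonad \<Rightarrow> 'l mmonad" where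
  "mren_val r (MVar n) = MVar (r n)"
| "mren_val r MUnit = MUnit"
| "mren_val r (MPair V W) = MPair (mren_val r V) (mren_val r W)"
| "mren_val r (MInj l V) = MInj l (mren_val r V)"
| "mren_val r (MThunk M) = MThunk (mren_comp r M)"
| "mren_comp r (MSplit V M) = MSplit (mren_val r V) (mren_comp (ren_up (ren_up r)) M)"
| "mren_comp r (MCase V Ms) = MCase (mren_val r V) (fmmap (\<lambda>M. mren_comp (ren_up r) M) Ms)"
| "mren_comp r (MForce V) = MForce (mren_val r V)"
| "mren_comp r (MReturn V) = MReturn (mren_val r V)"
| "mren_comp r (MLet M N) = MLet (mren_comp r M) (mren_comp (ren_up r) N)"
| "mren_comp r (MLam M) = MLam (mren_comp (ren_up r) M)"
| "mren_comp r (MApp M V) = MApp (mren_comp r M) (mren_val r V)"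
| "mren_comp r (MCPair M N) = MCPair (mren_comp r M) (mren_comp r N)"
| "mren_comp r (MPrj i M) = MPrj i (mren_comp r M)"
| "mren_comp r (MReflect N) = MReflect (mren_comp r N)"
| "mren_comp r (MReify T M) = MReify (mren_monad r T) (mren_comp r M)"
| "mren_monad r (MWhere Nu Nb) = MWhere (mren_comp (ren_up r) Nu) (mren_comp (ren_up (ren_up r)) Nb)"

definition mup :: "(nat \<Rightarrow> 'l mvalue) \<Rightarrow> nat \<Rightarrow> 'l mvalue" where
  "mup s n = (case n of 0 \<Rightarrow> MVar 0 | Suc k \<Rightarrow> mren_val Suc (s k))"

primrec msub_val :: "(nat \<Rightarrow> 'l mvalue) \<Rightarrow> 'l mvalue \<Rightarrow> 'l mvalue"
  and msub_comp :: "(nat \<Rightarrow> 'l mvalue) \<Rightarrow> 'l mcomp \<Rightarrow> 'l mcomp"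
  and msub_monad :: "(nat \<Rightarrow> 'l mvalue) \<Rightarrow> 'l mmonad \<Rightarrow> 'l mmonad" where
  "msub_val s (MVar n) = s n"
| "msub_val s MUnit = MUnit"
| "msub_val s (MPair V W) = MPair (msub_val s V) (msub_val s W)"
| "msub_val s (MInj l V) = MInj l (msub_val s V)"
| "msub_val s (MThunk M) = MThunk (msub_comp s M)"
| "msub_comp s (MSplit V M) = MSplit (msub_val s V) (msub_comp (mup (mup s)) M)"
| "msub_comp s (MCase V Ms) = MCase (msub_val s V) (fmmap (\<lambda>M. msub_comp (mup s) M) Ms)"
| "msub_comp s (MForce V) = MForce (msub_val s V)"
| "msub_comp s (MReturn V) = MReturn (msub_val s V)"
| "msub_comp s (MLet M N) = MLet (msub_comp s M) (msub_comp (mup s) N)"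
| "msub_comp s (MLam M) = MLam (msub_comp (mup s) M)"
| "msub_comp s (MApp M V) = MApp (msub_comp s M) (msub_val s V)"
| "msub_comp s (MCPair M N) = MCPair (msub_comp s M) (msub_comp s N)"
| "msub_comp s (MPrj i M) = MPrj i (msub_comp s M)"
| "msub_comp s (MReflect N) = MReflect (msub_comp s N)"
| "msub_comp s (MReify T M) = MReify (msub_monad s T) (msub_comp s M)"
| "msub_monad s (MWhere Nu Nb) = MWhere (msub_comp (mup s) Nu) (msub_comp (mup (mup s)) Nb)"

definition msubst1 :: "'l mcomp \<Rightarrow> 'l mvalue \<Rightarrow> 'l mcomp" where
  "msubst1 M V = msub_comp (case_nat V MVar) M"

definition msubst2 :: "'l mcomp \<Rightarrow> 'l mvalue \<Rightarrow> 'l mvalue \<Rightarrow> 'l mcomp" where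
  "msubst2 M V W = msub_comp (case_nat V (case_nat W MVar)) M"

datatype 'l mframe =
    MFLet "'l mcomp"
  | MFApp "'l mvalue"
  | MFPrj side

primrec mplug_frame :: "'l mframe \<Rightarrow> 'l mcomp \<Rightarrow> 'l mcomp" where
  "mplug_frame (MFLet N) M = MLet M N"
| "mplug_frame (MFApp V) M = MApp M V"
| "mplug_frame (MFPrj i) M = MPrj i M"

primrec mren_frame :: "(nat \<Rightarrow> nat) \<Rightarrow> 'l mframe \<Rightarrow> 'l mframe" where
  "mren_frame r (MFLet N) = MFLet (mren_comp (ren_up r) N)"
| "mren_frame r (MFApp V) = MFApp (mren_val r V)"
| "mren_frame r (MFPrj i) = MFPrj i"

datatype 'l mhoist =
    MHHole
  | MHFrame "'l mhoist" "'l mframe"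

primrec mplug_hoist :: "'l mhoist \<Rightarrow> 'l mcomp \<Rightarrow> 'l mcomp" where
  "mplug_hoist MHHole M = M"
| "mplug_hoist (MHFrame H B) M = mplug_hoist H (mplug_frame B M)"

primrec mren_hoist :: "(nat \<Rightarrow> nat) \<Rightarrow> 'l mhoist \<Rightarrow> 'l mhoist" where
  "mren_hoist r MHHole = MHHole"
| "mren_hoist r (MHFrame H B) = MHFrame (mren_hoist r H) (mren_frame r B)"

datatype 'l mectx =
    MKHole
  | MKFrame "'l mectx" "'l mframe"
  | MKReify "'l mectx" "'l mmonad"

primrec mplug :: "'l mectx \<Rightarrow> 'l mcomp \<Rightarrow> 'l mcomp" where
  "mplug MKHole M = M"
| "mplug (MKFrame K B) M = mplug K (mplug_frame B M)"
| "mplug (MKReify K T) M = mplug K (MReify T M)"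

text \<open>The captured continuation is placed under a \<open>\<lambda>\<close>, so its free variables are
  shifted by \<open>Suc\<close>; the effect handler calculus does the same.\<close>

inductive mbeta :: "'l mcomp \<Rightarrow> 'l mcomp \<Rightarrow> bool" where
  mbeta_split: "mbeta (MSplit (MPair V W) M) (msubst2 M V W)"
| mbeta_case: "fmlookup Ms l = Some M \<Longrightarrow> mbeta (MCase (MInj l V) Ms) (msubst1 M V)"
| mbeta_force: "mbeta (MForce (MThunk M)) M"
| mbeta_let: "mbeta (MLet (MReturn V) N) (msubst1 N V)"
| mbeta_app: "mbeta (MApp (MLam M) V) (msubst1 M V)"
| mbeta_prj_fst: "mbeta (MPrj Fst (MCPair M N)) M"
| mbeta_prj_snd: "mbeta (MPrj Snd (MCPair M N)) N"
| mbeta_reify_return: "mbeta (MReify (MWhere Nu Nb) (MReturn V)) (msubst1 Nu V)"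
| mbeta_reify_reflect: "T = MWhere Nu Nb \<Longrightarrow>
    mbeta (MReify T (mplug_hoist H (MReflect N)))
      (msubst2 Nb (MThunk N)
        (MThunk (MLam (MReify (mren_monad Suc T) (mplug_hoist (mren_hoist Suc H) (MReturn (MVar 0)))))))"

inductive mstep :: "'l mcomp \<Rightarrow> 'l mcomp \<Rightarrow> bool" where
  mstepI: "mbeta M N \<Longrightarrow> mstep (mplug K M) (mplug K N)"

section \<open>The effect handler calculus\<close>

datatype ('l, 'o) evalue =
    EVar nat
  | EUnit
  | EPair "('l, 'o) evalue" "('l, 'o) evalue"
  | EInj 'l "('l, 'o) evalue"
  | EThunk "('l, 'o) ecomp"
and ('l, 'o) ecomp =
    ESplit "('l, 'o) evalue" "('l, 'o) ecomp"
  | ECase "('l, 'o) evalue" "('l, ('l, 'o) ecomp) fmap"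
  | EForce "('l, 'o) evalue"
  | EReturn "('l, 'o) evalue"
  | ELet "('l, 'o) ecomp" "('l, 'o) ecomp"
  | ELam "('l, 'o) ecomp"
  | EApp "('l, 'o) ecomp" "('l, 'o) evalue"
  | ECPair "('l, 'o) ecomp" "('l, 'o) ecomp"
  | EPrj side "('l, 'o) ecomp"
  | EOp 'o "('l, 'o) evalue"
  | EHandle "('l, 'o) ecomp" "('l, 'o) ehandler"
and ('l, 'o) ehandler =
    EHandler "('l, 'o) ecomp" "('o, ('l, 'o) ecomp) fmap"

primrec eren_val :: "(nat \<Rightarrow> nat) \<Rightarrow> ('l, 'o) evalue \<Rightarrow> ('l, 'o) evalue"
  and eren_comp :: "(nat \<Rightarrow> nat) \<Rightarrow> ('l, 'o) ecomp \<Rightarrow> ('l, 'o) ecomp"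
  and eren_handler :: "(nat \<Rightarrow> nat) \<Rightarrow> ('l, 'o) ehandler \<Rightarrow> ('l, 'o) ehandler" where
  "eren_val r (EVar n) = EVar (r n)"
| "eren_val r EUnit = EUnit"
| "eren_val r (EPair V W) = EPair (eren_val r V) (eren_val r W)"
| "eren_val r (EInj l V) = EInj l (eren_val r V)"
| "eren_val r (EThunk M) = EThunk (eren_comp r M)"
| "eren_comp r (ESplit V M) = ESplit (eren_val r V) (eren_comp (ren_up (ren_up r)) M)"
| "eren_comp r (ECase V Ms) = ECase (eren_val r V) (fmmap (\<lambda>M. eren_comp (ren_up r) M) Ms)"
| "eren_comp r (EForce V) = EForce (eren_val r V)"
| "eren_comp r (EReturn V) = EReturn (eren_val r V)"
| "eren_comp r (ELet M N) = ELet (eren_comp r M) (eren_comp (ren_up r) N)"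
| "eren_comp r (ELam M) = ELam (eren_comp (ren_up r) M)"
| "eren_comp r (EApp M V) = EApp (eren_comp r M) (eren_val r V)"
| "eren_comp r (ECPair M N) = ECPair (eren_comp r M) (eren_comp r N)"
| "eren_comp r (EPrj i M) = EPrj i (eren_comp r M)"
| "eren_comp r (EOp op V) = EOp op (eren_val r V)"
| "eren_comp r (EHandle M H) = EHandle (eren_comp r M) (eren_handler r H)"
| "eren_handler r (EHandler Nret Nops) =
    EHandler (eren_comp (ren_up r) Nret) (fmmap (\<lambda>N. eren_comp (ren_up (ren_up r)) N) Nops)"

definition eup :: "(nat \<Rightarrow> ('l, 'o) evalue) \<Rightarrow> nat \<Rightarrow> ('l, 'o) evalue" where
  "eup s n = (case n of 0 \<Rightarrow> EVar 0 | Suc k \<Rightarrow> eren_val Suc (s k))"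

primrec esub_val :: "(nat \<Rightarrow> ('l, 'o) evalue) \<Rightarrow> ('l, 'o) evalue \<Rightarrow> ('l, 'o) evalue"
  and esub_comp :: "(nat \<Rightarrow> ('l, 'o) evalue) \<Rightarrow> ('l, 'o) ecomp \<Rightarrow> ('l, 'o) ecomp"
  and esub_handler :: "(nat \<Rightarrow> ('l, 'o) evalue) \<Rightarrow> ('l, 'o) ehandler \<Rightarrow> ('l, 'o) ehandler" where
  "esub_val s (EVar n) = s n"
| "esub_val s EUnit = EUnit"
| "esub_val s (EPair V W) = EPair (esub_val s V) (esub_val s W)"
| "esub_val s (EInj l V) = EInj l (esub_val s V)"
| "esub_val s (EThunk M) = EThunk (esub_comp s M)"
| "esub_comp s (ESplit V M) = ESplit (esub_val s V) (esub_comp (eup (eup s)) M)"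
| "esub_comp s (ECase V Ms) = ECase (esub_val s V) (fmmap (\<lambda>M. esub_comp (eup s) M) Ms)"
| "esub_comp s (EForce V) = EForce (esub_val s V)"
| "esub_comp s (EReturn V) = EReturn (esub_val s V)"
| "esub_comp s (ELet M N) = ELet (esub_comp s M) (esub_comp (eup s) N)"
| "esub_comp s (ELam M) = ELam (esub_comp (eup s) M)"
| "esub_comp s (EApp M V) = EApp (esub_comp s M) (esub_val s V)"
| "esub_comp s (ECPair M N) = ECPair (esub_comp s M) (esub_comp s N)"
| "esub_comp s (EPrj i M) = EPrj i (esub_comp s M)"
| "esub_comp s (EOp op V) = EOp op (esub_val s V)"
| "esub_comp s (EHandle M H) = EHandle (esub_comp s M) (esub_handler s H)"
| "esub_handler s (EHandler Nret Nops) =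
    EHandler (esub_comp (eup s) Nret) (fmmap (\<lambda>N. esub_comp (eup (eup s)) N) Nops)"

definition esubst1 :: "('l, 'o) ecomp \<Rightarrow> ('l, 'o) evalue \<Rightarrow> ('l, 'o) ecomp" where
  "esubst1 M V = esub_comp (case_nat V EVar) M"

definition esubst2 :: "('l, 'o) ecomp \<Rightarrow> ('l, 'o) evalue \<Rightarrow> ('l, 'o) evalue \<Rightarrow> ('l, 'o) ecomp" where
  "esubst2 M V W = esub_comp (case_nat V (case_nat W EVar)) M"

datatype ('l, 'o) eframe =
    EFLet "('l, 'o) ecomp"
  | EFApp "('l, 'o) evalue"
  | EFPrj side

primrec eplug_frame :: "('l, 'o) eframe \<Rightarrow> ('l, 'o) ecomp \<Rightarrow> ('l, 'o) ecomp" where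
  "eplug_frame (EFLet N) M = ELet M N"
| "eplug_frame (EFApp V) M = EApp M V"
| "eplug_frame (EFPrj i) M = EPrj i M"

primrec eren_frame :: "(nat \<Rightarrow> nat) \<Rightarrow> ('l, 'o) eframe \<Rightarrow> ('l, 'o) eframe" where
  "eren_frame r (EFLet N) = EFLet (eren_comp (ren_up r) N)"
| "eren_frame r (EFApp V) = EFApp (eren_val r V)"
| "eren_frame r (EFPrj i) = EFPrj i"

datatype ('l, 'o) ehoist =
    EHHole
  | EHFrame "('l, 'o) ehoist" "('l, 'o) eframe"

primrec eplug_hoist :: "('l, 'o) ehoist \<Rightarrow> ('l, 'o) ecomp \<Rightarrow> ('l, 'o) ecomp" where
  "eplug_hoist EHHole M = M"
| "eplug_hoist (EHFrame H B) M = eplug_hoist H (eplug_frame B M)"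

primrec eren_hoist :: "(nat \<Rightarrow> nat) \<Rightarrow> ('l, 'o) ehoist \<Rightarrow> ('l, 'o) ehoist" where
  "eren_hoist r EHHole = EHHole"
| "eren_hoist r (EHFrame H B) = EHFrame (eren_hoist r H) (eren_frame r B)"

datatype ('l, 'o) eectx =
    EKHole
  | EKFrame "('l, 'o) eectx" "('l, 'o) eframe"
  | EKHandle "('l, 'o) eectx" "('l, 'o) ehandler"

primrec eplug :: "('l, 'o) eectx \<Rightarrow> ('l, 'o) ecomp \<Rightarrow> ('l, 'o) ecomp" where
  "eplug EKHole M = M"
| "eplug (EKFrame K B) M = eplug K (eplug_frame B M)"
| "eplug (EKHandle K H) M = eplug K (EHandle M H)"

inductive ebeta :: "('l, 'o) ecomp \<Rightarrow> ('l, 'o) ecomp \<Rightarrow> bool" where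
  ebeta_split: "ebeta (ESplit (EPair V W) M) (esubst2 M V W)"
| ebeta_case: "fmlookup Ms l = Some M \<Longrightarrow> ebeta (ECase (EInj l V) Ms) (esubst1 M V)"
| ebeta_force: "ebeta (EForce (EThunk M)) M"
| ebeta_let: "ebeta (ELet (EReturn V) N) (esubst1 N V)"
| ebeta_app: "ebeta (EApp (ELam M) V) (esubst1 M V)"
| ebeta_prj_fst: "ebeta (EPrj Fst (ECPair M N)) M"
| ebeta_prj_snd: "ebeta (EPrj Snd (ECPair M N)) N"
| ebeta_handle_return: "ebeta (EHandle (EReturn V) (EHandler Nret Nops)) (esubst1 Nret V)"
| ebeta_handle_op: "H = EHandler Nret Nops \<Longrightarrow> fmlookup Nops op = Some N \<Longrightarrow>
    ebeta (EHandle (eplug_hoist C (EOp op V)) H)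
      (esubst2 N V
        (EThunk (ELam (EHandle (eplug_hoist (eren_hoist Suc C) (EReturn (EVar 0))) (eren_handler Suc H)))))"

inductive estep :: "('l, 'o) ecomp \<Rightarrow> ('l, 'o) ecomp \<Rightarrow> bool" where
  estepI: "ebeta M N \<Longrightarrow> estep (eplug K M) (eplug K N)"

section \<open>The translation\<close>

primrec trans_val :: "'o \<Rightarrow> 'l mvalue \<Rightarrow> ('l, 'o) evalue"
  and trans_comp :: "'o \<Rightarrow> 'l mcomp \<Rightarrow> ('l, 'o) ecomp"
  and trans_monad :: "'o \<Rightarrow> 'l mmonad \<Rightarrow> ('l, 'o) ehandler" where
  "trans_val rfl (MVar n) = EVar n"
| "trans_val rfl MUnit = EUnit"
| "trans_val rfl (MPair V W) = EPair (trans_val rfl V) (trans_val rfl W)"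
| "trans_val rfl (MInj l V) = EInj l (trans_val rfl V)"
| "trans_val rfl (MThunk M) = EThunk (trans_comp rfl M)"
| "trans_comp rfl (MSplit V M) = ESplit (trans_val rfl V) (trans_comp rfl M)"
| "trans_comp rfl (MCase V Ms) = ECase (trans_val rfl V) (fmmap (\<lambda>M. trans_comp rfl M) Ms)"
| "trans_comp rfl (MForce V) = EForce (trans_val rfl V)"
| "trans_comp rfl (MReturn V) = EReturn (trans_val rfl V)"
| "trans_comp rfl (MLet M N) = ELet (trans_comp rfl M) (trans_comp rfl N)"
| "trans_comp rfl (MLam M) = ELam (trans_comp rfl M)"
| "trans_comp rfl (MApp M V) = EApp (trans_comp rfl M) (trans_val rfl V)"
| "trans_comp rfl (MCPair M N) = ECPair (trans_comp rfl M) (trans_comp rfl N)"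
| "trans_comp rfl (MPrj i M) = EPrj i (trans_comp rfl M)"
| "trans_comp rfl (MReflect N) = EOp rfl (EThunk (trans_comp rfl N))"
| "trans_comp rfl (MReify T M) = EHandle (trans_comp rfl M) (trans_monad rfl T)"
| "trans_monad rfl (MWhere Nu Nb) =
    EHandler (trans_comp rfl Nu) (fmupd rfl (trans_comp rfl Nb) fmempty)"

end

theory Submission
  imports Defs
begin

text \<open>
  The translation is homomorphic in the core constructs, so it commutes with renaming, hence with
  substitution, and with plugging into frames, hoisting contexts and evaluation contexts.  Every
  \<open>\<beta>\<close>-redex is therefore translated to a \<open>\<beta>\<close>-redex whose contractum is the translated contractum,
  so one step is simulated by exactly one step.
\<close>

text \<open>Both calculi bind the same variables in the same order, a bind clause's
  \<open>y\<close>, \<open>f\<close> matching an operation clause's \<open>p\<close>,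
  \<open>k\<close>, so lifting under binders agrees on both sides.\<close>

lemma trans_ren:
  fixes V :: "'l mvalue" and M :: "'l mcomp" and T :: "'l mmonad" and rfl :: 'o
  shows "trans_val rfl (mren_val r V) = eren_val r (trans_val rfl V)"
  "trans_comp rfl (mren_comp r M) = eren_comp r (trans_comp rfl M)"
  "trans_monad rfl (mren_monad r T) = eren_handler r (trans_monad rfl T)"
  by (induction V and M and T arbitrary: r and r and r)
    (auto simp: fmap.map_comp fmmap_fmupd intro!: fmap.map_cong0)

text \<open>Lifting shifts the substituted values by \<open>Suc\<close>, which is why renaming is
  treated before substitution.\<close>

lemma trans_mup: "trans_val rfl (mup s n) = eup (\<lambda>k. trans_val rfl (s k)) n"
  by (auto simp: mup_def eup_def trans_ren split: nat.split)

lemma trans_sub: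
  "trans_val rfl (msub_val s V) = esub_val (\<lambda>k. trans_val rfl (s k)) (trans_val rfl V)"
  "trans_comp rfl (msub_comp s M) = esub_comp (\<lambda>k. trans_val rfl (s k)) (trans_comp rfl M)"
  "trans_monad rfl (msub_monad s T) = esub_handler (\<lambda>k. trans_val rfl (s k)) (trans_monad rfl T)"
  by (induction V and M and T arbitrary: s and s and s)
    (auto simp: fmap.map_comp fmmap_fmupd trans_mup[abs_def] intro!: fmap.map_cong0)

lemma trans_subst1: "trans_comp rfl (msubst1 M V) = esubst1 (trans_comp rfl M) (trans_val rfl V)"
proof -
  have "(\<lambda>k. trans_val rfl (case_nat V MVar k)) = case_nat (trans_val rfl V) EVar"
    by (auto split: nat.split)
  then show ?thesis
    by (simp add: msubst1_def esubst1_def trans_sub)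
qed

lemma trans_subst2:
  "trans_comp rfl (msubst2 M V W) = esubst2 (trans_comp rfl M) (trans_val rfl V) (trans_val rfl W)"
proof -
  have "(\<lambda>k. trans_val rfl (case_nat V (case_nat W MVar) k))
      = case_nat (trans_val rfl V) (case_nat (trans_val rfl W) EVar)"
    by (auto split: nat.split)
  then show ?thesis
    by (simp add: msubst2_def esubst2_def trans_sub)
qed

primrec trans_frame :: "'o \<Rightarrow> 'l mframe \<Rightarrow> ('l, 'o) eframe" where
  "trans_frame rfl (MFLet N) = EFLet (trans_comp rfl N)"
| "trans_frame rfl (MFApp V) = EFApp (trans_val rfl V)"
| "trans_frame rfl (MFPrj i) = EFPrj i"

text \<open>Basic frames go to basic frames, so the image contains no handler and can be captured
  whole by an enclosing one.\<close>

primrec trans_hoist :: "'o \<Rightarrow> 'l mhoist \<Rightarrow> ('l, 'o) ehoist" where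
  "trans_hoist rfl MHHole = EHHole"
| "trans_hoist rfl (MHFrame H B) = EHFrame (trans_hoist rfl H) (trans_frame rfl B)"

primrec trans_ectx :: "'o \<Rightarrow> 'l mectx \<Rightarrow> ('l, 'o) eectx" where
  "trans_ectx rfl MKHole = EKHole"
| "trans_ectx rfl (MKFrame K B) = EKFrame (trans_ectx rfl K) (trans_frame rfl B)"
| "trans_ectx rfl (MKReify K T) = EKHandle (trans_ectx rfl K) (trans_monad rfl T)"

lemma trans_plug_frame:
  "trans_comp rfl (mplug_frame B M) = eplug_frame (trans_frame rfl B) (trans_comp rfl M)"
  by (cases B) simp_all

lemma trans_plug_hoist:
  "trans_comp rfl (mplug_hoist H M) = eplug_hoist (trans_hoist rfl H) (trans_comp rfl M)"
  by (induction H arbitrary: M) (simp_all add: trans_plug_frame)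

lemma trans_plug: "trans_comp rfl (mplug K M) = eplug (trans_ectx rfl K) (trans_comp rfl M)"
  by (induction K arbitrary: M) (simp_all add: trans_plug_frame)

lemma trans_ren_frame: "trans_frame rfl (mren_frame r B) = eren_frame r (trans_frame rfl B)"
  by (cases B) (simp_all add: trans_ren)

text \<open>Serves the captured continuation, whose hoisting context moves under a \<lambda> and is
  shifted by \<open>Suc\<close>.\<close>

lemma trans_ren_hoist: "trans_hoist rfl (mren_hoist r H) = eren_hoist r (trans_hoist rfl H)"
  by (induction H) (simp_all add: trans_ren_frame)

lemma trans_beta:
  assumes "mbeta M N"
  shows "ebeta (trans_comp rfl M) (trans_comp rfl N)"
  using assms
proof cases
  case (mbeta_reify_reflect T Nu Nb H L)
  \<comment> \<open>The operation's argument is already the thunk that the monadic rule substitutes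
    for \<open>y\<close>.\<close>
  have "ebeta (EHandle (eplug_hoist (trans_hoist rfl H) (EOp rfl (EThunk (trans_comp rfl L))))
      (trans_monad rfl T))
    (esubst2 (trans_comp rfl Nb) (EThunk (trans_comp rfl L))
      (EThunk (ELam (EHandle
        (eplug_hoist (eren_hoist Suc (trans_hoist rfl H)) (EReturn (EVar 0)))
        (eren_handler Suc (trans_monad rfl T))))))"
    \<comment> \<open>The handler's only clause is for \<open>rfl\<close>, so the lookup yields the
      translated bind clause.\<close>
    by (rule ebeta_handle_op[where Nops = "fmupd rfl (trans_comp rfl Nb) fmempty"])
      (simp_all add: mbeta_reify_reflect(3))
  then show ?thesis
    unfolding mbeta_reify_reflect(1,2)
    by (simp add: trans_plug_hoist trans_subst2 trans_ren_hoist trans_ren)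
qed (auto simp: trans_subst1 trans_subst2 intro: ebeta.intros)

theorem theorem6p8:
  fixes reflect_op :: 'o and M N :: "'l mcomp"
  assumes "mstep M N"
  shows "estep\<^sup>+\<^sup>+ (trans_comp reflect_op M) (trans_comp reflect_op N)"
  using assms
proof cases
  case (mstepI M' N' K)
  \<comment> \<open>The image of \<open>K\<close> is an evaluation context, each reify layer
    becoming a handler, so the contracted redex stays in evaluation position.\<close>
  then have "estep (trans_comp reflect_op M) (trans_comp reflect_op N)"
    by (simp add: trans_plug trans_beta estepI)
  then show ?thesis
    by (rule tranclp.r_into_trancl)
qed

end
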